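(* Let $\mathcal{X},\mathcal{Z}$ be finite sets, let $P_{XZ}$ be a probability distribution on $\mathcal{X}\times\mathcal{Z}$, let $n\ge1$, and let $(X^n,Z^n)=((X_1,Z_1),\dots,(X_n,Z_n))$ be i.i.d. with common distribution $P_{XZ}$. For every Slepian–Wolf code $\Phi_n=(\phi_n,\psi_n)$ for principal source $X^n$ with side-information $Z^n$, $$\varepsilon(\Phi_n)+\Delta(\phi_n)\ \ge\ \delta(P_{X^nZ^n}).$$
   Context: A Slepian–Wolf code (source coding with full side-information at the decoder) is a pair of an encoder $\phi_n:\mathcal{X}^n\to\mathcal{M}_n=\{1,\dots,M_n\}$ and a decoder $\psi_n:\mathcal{M}_n\times\mathcal{Z}^n\to\mathcal{X}^n$; its error probability is $\varepsilon(\Phi_n)=P_{X^nZ^n}(\{(x^n,z^n):\psi_n(\phi_n(x^n),z^n)\ne x^n\})$. For probability distributions $P,Q$ on a finite set $\mathcal{A}$, $d(P,Q)=\frac12\sum_{a\in\mathcal{A}}|P(a)-Q(a)|$. With $S_n=\phi_n(X^n)$ and $P_{U_n}$ the uniform distribution on $\mathcal{M}_n$, define $\Delta(\phi_n)=d(P_{S_nZ^n},P_{U_n}\times P_{Z^n})$. Definition of $\delta(P_{X^nZ^n})$: for an integer $1\le M\le|\mathcal{X}|^n$ and a family $\mathcal{C}_n=\{\mathcal{C}_{z^n}\}_{z^n\in\mathcal{Z}^n}$ of subsets $\mathcal{C}_{z^n}\subset\mathcal{X}^n$ with $|\mathcal{C}_{z^n}|=M$ for every $z^n$, let $P_{\mathcal{C}_n}$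 be the distribution on $\mathcal{X}^n\times\mathcal{Z}^n$ with $P_{\mathcal{C}_n}(x^n,z^n)=\frac1M P_{Z^n}(z^n)$ if $x^n\in\mathcal{C}_{z^n}$ and $0$ otherwise. Then $\delta(P_{X^nZ^n})=\min_{\mathcal{C}_n}d(P_{X^nZ^n},P_{\mathcal{C}_n})$, where the minimum is over all such families for all integers $1\le M\le|\mathcal{X}|^n$. *)

theory Defs
  imports "HOL-Probability.Probability"
begin

definition words :: "nat \<Rightarrow> 'a set \<Rightarrow> 'a list set" where
  "words n A = {xs. set xs \<subseteq> A \<and> length xs = n}"

text \<open>The joint law of \<open>(X\<^sup>n, Z\<^sup>n)\<close> when \<open>(X\<^sub>1, Z\<^sub>1), \<dots>, (X\<^sub>n, Z\<^sub>n)\<close> are i.i.d. with law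
  \<open>P\<close>: \<^const>\<open>replicate_pmf\<close> is the law of the i.i.d. sequence of pairs, which is then
  regrouped into a pair of sequences.\<close>

definition iid_joint :: "nat \<Rightarrow> ('x \<times> 'z) pmf \<Rightarrow> ('x list \<times> 'z list) pmf" where
  "iid_joint n P = map_pmf (\<lambda>w. (map fst w, map snd w)) (replicate_pmf n P)"

definition var_dist :: "'a set \<Rightarrow> ('a \<Rightarrow> real) \<Rightarrow> ('a \<Rightarrow> real) \<Rightarrow> real" where
  "var_dist A p q = 1 / 2 * (\<Sum>a\<in>A. \<bar>p a - q a\<bar>)"

definition slepian_wolf_code ::
  "nat \<Rightarrow> 'x set \<Rightarrow> 'z set \<Rightarrow> nat \<Rightarrow> ('x list \<Rightarrow> nat) \<Rightarrow> (nat \<times> 'z list \<Rightarrow> 'x list) \<Rightarrow> bool" where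
  "slepian_wolf_code n X Z m \<phi> \<psi> \<longleftrightarrow>
     \<phi> \<in> words n X \<rightarrow> {1..m} \<and> \<psi> \<in> {1..m} \<times> words n Z \<rightarrow> words n X"

text \<open>Below, \<open>Q\<close> stands for the joint law of \<open>(X\<^sup>n, Z\<^sup>n)\<close>.\<close>

definition error_prob ::
  "('x list \<times> 'z list) pmf \<Rightarrow> ('x list \<Rightarrow> nat) \<Rightarrow> (nat \<times> 'z list \<Rightarrow> 'x list) \<Rightarrow> real" where
  "error_prob Q \<phi> \<psi> = measure_pmf.prob Q {(x, z). \<psi> (\<phi> x, z) \<noteq> x}"

definition security_dist ::
  "nat \<Rightarrow> 'z set \<Rightarrow> ('x list \<times> 'z list) pmf \<Rightarrow> nat \<Rightarrow> ('x list \<Rightarrow> nat) \<Rightarrow> real" where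
  "security_dist n Z Q m \<phi> =
     var_dist ({1..m} \<times> words n Z)
       (pmf (map_pmf (\<lambda>(x, z). (\<phi> x, z)) Q))
       (pmf (pair_pmf (pmf_of_set {1..m}) (map_pmf snd Q)))"

definition set_families :: "nat \<Rightarrow> 'x set \<Rightarrow> 'z set \<Rightarrow> (nat \<times> ('z list \<Rightarrow> 'x list set)) set" where
  "set_families n X Z =
     (SIGMA M : {1..card X ^ n}. words n Z \<rightarrow>\<^sub>E {A. A \<subseteq> words n X \<and> card A = M})"

definition family_dist ::
  "('x list \<times> 'z list) pmf \<Rightarrow> nat \<Rightarrow> ('z list \<Rightarrow> 'x list set) \<Rightarrow> 'x list \<times> 'z list \<Rightarrow> real" where
  "family_dist Q M C = (\<lambda>(x, z). if x \<in> C z then 1 / real M * pmf (map_pmf snd Q) z else 0)"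

definition delta :: "nat \<Rightarrow> 'x set \<Rightarrow> 'z set \<Rightarrow> ('x list \<times> 'z list) pmf \<Rightarrow> real" where
  "delta n X Z Q =
     Min ((\<lambda>(M, C). var_dist (words n X \<times> words n Z) (pmf Q) (family_dist Q M C))
            ` set_families n X Z)"

text \<open>The following two facts ensure that the minimum in \<^const>\<open>delta\<close> is taken over a finite,
  nonempty set.\<close>

lemma finite_words: "finite A \<Longrightarrow> finite (words n A)"
  unfolding words_def by (rule finite_lists_length_eq)

lemma finite_set_families:
  assumes "finite X" "finite Z"
  shows "finite (set_families n X Z)"
proof -
  have "finite {A. A \<subseteq> words n X \<and> card A = M}" for M
    by (rule finite_subset[of _ "Pow (words n X)"]) (auto simp: finite_words assms)
  then show ?thesis
    unfolding set_families_def using assms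
    by (intro finite_SigmaI finite_PiE finite_words) auto
qed

lemma set_families_nonempty:
  assumes "finite X" "X \<noteq> {}"
  shows "set_families n X Z \<noteq> {}"
proof -
  have "card (words n X) = card X ^ n"
    unfolding words_def using assms(1) by (rule card_lists_length_eq)
  moreover have "card X \<ge> 1"
    using assms by (simp add: Suc_leI card_gt_0_iff)
  ultimately have "(card X ^ n, restrict (\<lambda>_. words n X) (words n Z)) \<in> set_families n X Z"
    unfolding set_families_def by auto
  then show ?thesis by blast
qed

end

theory Submission
  imports Defs
begin

text \<open>
  Let \<open>D\<^sub>z\<close> be the set of words that are decoded correctly under side-information \<open>z\<close>. The encoder is
  injective on \<open>D\<^sub>z\<close>, so \<open>D\<^sub>z\<close> has at most \<open>M = min m (|X| ^ n)\<close> elements and extends to a set \<open>C\<^sub>z\<close>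
  of size \<open>M\<close>. The variational distance of two probability distributions is the sum of the positive
  parts of their difference. For \<open>P\<^sub>C\<close>, the positive parts at words outside \<open>D\<^sub>z\<close> add up to at most
  the error probability. At a word \<open>x \<in> D\<^sub>z\<close> the positive part is at most
  \<open>(P(\<phi> x, z) - P(z) / m)\<^sup>+\<close>, and by injectivity of \<open>\<phi>\<close> on \<open>D\<^sub>z\<close> these terms add up to at most the
  security distance.
\<close>

lemma card_words: "finite A \<Longrightarrow> card (words n A) = card A ^ n"
  unfolding words_def by (rule card_lists_length_eq)

lemma set_pmf_iid_joint:
  assumes "set_pmf P \<subseteq> X \<times> Z"
  shows "set_pmf (iid_joint n P) \<subseteq> words n X \<times> words n Z"
  using assms unfolding iid_joint_def words_def
  by (fastforce simp: set_replicate_pmf in_lists_conv_set)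

text \<open>Pointwise \<open>\<bar>t\<bar> = 2 * max 0 t - t\<close>, and the linear terms cancel
  because both functions have the same total.\<close>

lemma var_dist_eq_sum_pos_part:
  assumes "sum p A = sum q A"
  shows "var_dist A p q = (\<Sum>a\<in>A. max 0 (p a - q a))"
proof -
  have "(\<Sum>a\<in>A. \<bar>p a - q a\<bar>) = (\<Sum>a\<in>A. 2 * max 0 (p a - q a) - (p a - q a))"
    by (rule sum.cong) (auto simp: max_def)
  also have "\<dots> = 2 * (\<Sum>a\<in>A. max 0 (p a - q a))"
    using assms by (simp add: sum_subtractf sum_distrib_left)
  finally show ?thesis by (simp add: var_dist_def)
qed

text \<open>For fixed \<open>z\<close> the \<open>M\<close> words of \<open>C z\<close> carry mass
  \<open>1 / M\<close> times that of \<open>z\<close>, so the total is that of the marginal. This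
  supplies the equal totals needed for the positive-part formula.\<close>

lemma sum_family_dist:
  assumes "finite A" "finite B" "set_pmf (map_pmf snd Q) \<subseteq> B"
    and "\<And>z. z \<in> B \<Longrightarrow> C z \<subseteq> A \<and> card (C z) = M" and "M \<noteq> 0"
  shows "(\<Sum>w\<in>A \<times> B. family_dist Q M C w) = 1"
proof -
  have "(\<Sum>w\<in>A \<times> B. family_dist Q M C w) = (\<Sum>x\<in>A. \<Sum>z\<in>B. family_dist Q M C (x, z))"
    by (simp add: sum.cartesian_product)
  also have "\<dots> = (\<Sum>z\<in>B. \<Sum>x\<in>A. family_dist Q M C (x, z))"
    by (rule sum.swap)
  also have "\<dots> = (\<Sum>z\<in>B. pmf (map_pmf snd Q) z)"
  proof (rule sum.cong[OF refl])
    fix z assume "z \<in> B"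
    then have C: "C z \<subseteq> A" "card (C z) = M" using assms(4) by auto
    have "(\<Sum>x\<in>A. family_dist Q M C (x, z)) = (\<Sum>x\<in>A \<inter> C z. 1 / real M * pmf (map_pmf snd Q) z)"
      unfolding sum.inter_restrict[OF assms(1)] by (simp add: family_dist_def)
    also have "A \<inter> C z = C z" using C by auto
    finally show "(\<Sum>x\<in>A. family_dist Q M C (x, z)) = pmf (map_pmf snd Q) z"
      using C assms(5) by simp
  qed
  also have "\<dots> = 1"
    using assms by (intro sum_pmf_eq_1)
  finally show ?thesis .
qed

lemma slepian_wolf_bound:
  fixes Q :: "('x list \<times> 'z list) pmf"
  assumes fin: "finite X" "finite Z"
    and supp: "set_pmf Q \<subseteq> words n X \<times> words n Z"
    and code: "slepian_wolf_code n X Z m \<phi> \<psi>"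
  shows "delta n X Z Q \<le> error_prob Q \<phi> \<psi> + security_dist n Z Q m \<phi>"
proof -
  define W where "W = words n X"
  define V where "V = words n Z"
  have finW: "finite W" and finV: "finite V"
    using fin by (auto simp: W_def V_def finite_words)
  have supp': "set_pmf Q \<subseteq> W \<times> V" using supp by (simp add: W_def V_def)
  have \<phi>: "\<And>x. x \<in> W \<Longrightarrow> \<phi> x \<in> {1..m}"
    using code by (auto simp: slepian_wolf_code_def W_def)
  \<comment> \<open>A pmf has nonempty support, which excludes an empty word set and hence an empty
    message set.\<close>
  obtain w where "w \<in> W" using supp' set_pmf_not_empty[of Q] by fastforce
  then have m: "m \<noteq> 0" and "card W \<noteq> 0" using \<phi>[of w] finW by auto
  \<comment> \<open>\<open>m\<close> may exceed the number of words, so the set size is capped to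
    keep the family admissible.\<close>
  define M where "M = min m (card W)"
  have M: "M \<noteq> 0" "M \<le> m" "M \<le> card W" using m \<open>card W \<noteq> 0\<close> by (auto simp: M_def)
  define D where "D z = {x \<in> W. \<psi> (\<phi> x, z) = x}" for z
  have inj: "inj_on \<phi> (D z)" for z
    by (rule inj_on_inverseI[where g = "\<lambda>s. \<psi> (s, z)"]) (simp add: D_def)
  have "\<exists>C. D z \<subseteq> C \<and> C \<subseteq> W \<and> card C = M" for z
  proof -
    have "card (D z) \<le> card {1..m}"
      by (rule card_inj_on_le[OF inj]) (use \<phi> in \<open>auto simp: D_def\<close>)
    moreover have "card (D z) \<le> card W"
      using finW by (intro card_mono) (auto simp: D_def)
    ultimately have "card (D z) \<le> M" by (simp add: M_def)
    then obtain C where "D z \<subseteq> C" "C \<subseteq> W" "card C = M"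
      using exists_subset_between[of "D z" M W] M finW by (auto simp: D_def)
    then show ?thesis by blast
  qed
  then obtain C' where C': "\<And>z. D z \<subseteq> C' z \<and> C' z \<subseteq> W \<and> card (C' z) = M" by metis
  \<comment> \<open>\<open>set_families\<close> contains only functions that are
    \<open>undefined\<close> outside \<open>V\<close>.\<close>
  define C where "C = restrict C' V"
  have C: "D z \<subseteq> C z \<and> C z \<subseteq> W \<and> card (C z) = M" if "z \<in> V" for z
    using C' that by (simp add: C_def)
  let ?f = "\<lambda>w. max 0 (pmf Q w - family_dist Q M C w)"
  define G where "G = {(x, z) \<in> W \<times> V. \<psi> (\<phi> x, z) = x}"
  define B where "B = {(x, z) \<in> W \<times> V. \<psi> (\<phi> x, z) \<noteq> x}"
  have part: "W \<times> V = B \<union> G" and disj: "B \<inter> G = {}" by (auto simp: G_def B_def)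
  have "finite (B \<union> G)" unfolding part[symmetric] using finW finV by simp
  then have finB: "finite B" and finG: "finite G" by auto
  have "(M, C) \<in> set_families n X Z"
    using M C fin by (auto simp: set_families_def C_def V_def W_def card_words C')
  then have "delta n X Z Q \<le> var_dist (W \<times> V) (pmf Q) (family_dist Q M C)"
    unfolding delta_def using finite_set_families[OF fin]
    by (intro Min_le) (auto simp: W_def V_def image_iff intro!: bexI[of _ "(M, C)"])
  also have "\<dots> = sum ?f (W \<times> V)"
  proof (rule var_dist_eq_sum_pos_part)
    have "sum (family_dist Q M C) (W \<times> V) = 1"
      by (rule sum_family_dist) (use finW finV supp' C M in auto)
    then show "sum (pmf Q) (W \<times> V) = sum (family_dist Q M C) (W \<times> V)"
      using finW finV supp' by (simp add: sum_pmf_eq_1)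
  qed
  also have "\<dots> = sum ?f B + sum ?f G"
    unfolding part using finB finG disj by (rule sum.union_disjoint)
  also have "sum ?f B \<le> error_prob Q \<phi> \<psi>"
  proof -
    \<comment> \<open>Subtracting a nonnegative quantity cannot raise the positive part above
      \<open>pmf Q\<close>.\<close>
    have "sum ?f B \<le> sum (pmf Q) B"
      by (intro sum_mono) (auto simp: family_dist_def split: prod.splits)
    also have "\<dots> = measure_pmf.prob Q B"
      using finB by (simp add: measure_measure_pmf_finite)
    also have "\<dots> \<le> error_prob Q \<phi> \<psi>"
      unfolding error_prob_def by (intro measure_pmf.finite_measure_mono) (auto simp: B_def)
    finally show ?thesis .
  qed
  also have "sum ?f G \<le> security_dist n Z Q m \<phi>"
  proof -
    let ?R = "pmf (map_pmf (\<lambda>(x, z). (\<phi> x, z)) Q)"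
    let ?U = "pmf (pair_pmf (pmf_of_set {1..m}) (map_pmf snd Q))"
    let ?g = "\<lambda>v. max 0 (?R v - ?U v)"
    let ?h = "\<lambda>(x, z). (\<phi> x, z)"
    have "sum ?f G \<le> (\<Sum>w\<in>G. ?g (?h w))"
    proof (rule sum_mono)
      fix w assume "w \<in> G"
      then obtain x z where w: "w = (x, z)" "x \<in> W" "z \<in> V" "\<psi> (\<phi> x, z) = x" by (auto simp: G_def)
      then have "x \<in> C z" using C[of z] by (auto simp: D_def)
      \<comment> \<open>The point \<open>w\<close> lies in the fibre of \<open>?h\<close> over
        \<open>?h w\<close>, whose whole mass is \<open>?R (?h w)\<close>.\<close>
      have "pmf Q w \<le> ?R (?h w)"
        unfolding pmf_map w(1)
        by (subst pmf.rep_eq) (intro measure_pmf.finite_measure_mono, auto)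
      moreover have "?U (?h w) = pmf (map_pmf snd Q) z / real m"
        using m \<phi>[OF w(2)] by (simp add: w(1) pmf_pair)
      \<comment> \<open>Here \<open>M \<le> m\<close> is what counts: the mass subtracted on the
        left is at least the one subtracted on the right.\<close>
      moreover have "\<dots> \<le> pmf (map_pmf snd Q) z / real M"
        using M by (intro divide_left_mono) auto
      moreover have "\<dots> = family_dist Q M C w"
        using \<open>x \<in> C z\<close> by (simp add: w(1) family_dist_def)
      ultimately show "?f w \<le> ?g (?h w)" by linarith
    qed
    also have "\<dots> = sum ?g (?h ` G)"
    proof (rule sum.reindex[symmetric, unfolded comp_def])
      show "inj_on ?h G"
        \<comment> \<open>On \<open>G\<close> the decoder recovers \<open>x\<close> from its message
          and \<open>z\<close>.\<close>
        by (rule inj_on_inverseI[where g = "\<lambda>(s, z). (\<psi> (s, z), z)"]) (auto simp: G_def)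
    qed
    also have "\<dots> \<le> sum ?g ({1..m} \<times> V)"
    \<comment> \<open>The added terms are positive parts, hence nonnegative.\<close>
    proof (rule sum_mono2)
      show "?h ` G \<subseteq> {1..m} \<times> V" using \<phi> by (fastforce simp: G_def)
    qed (use finV in auto)
    also have "\<dots> = security_dist n Z Q m \<phi>"
      unfolding security_dist_def V_def[symmetric]
    proof (rule var_dist_eq_sum_pos_part[symmetric])
      have "set_pmf (map_pmf ?h Q) \<subseteq> {1..m} \<times> V" using supp' \<phi> by fastforce
      moreover have "set_pmf (pair_pmf (pmf_of_set {1..m}) (map_pmf snd Q)) \<subseteq> {1..m} \<times> V"
        using supp' m by auto
      ultimately show "sum ?R ({1..m} \<times> V) = sum ?U ({1..m} \<times> V)"
        using finV by (simp add: sum_pmf_eq_1 del: set_map_pmf set_pair_pmf)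
    qed
    finally show ?thesis .
  qed
  finally show ?thesis by simp
qed

theorem theorem10:
  fixes X :: "'x set" and Z :: "'z set" and P :: "('x \<times> 'z) pmf" and n m :: nat
    and \<phi> :: "'x list \<Rightarrow> nat" and \<psi> :: "nat \<times> 'z list \<Rightarrow> 'x list"
  assumes "finite X" and "finite Z"
    and "set_pmf P \<subseteq> X \<times> Z"
    and "n \<ge> 1"
    and "slepian_wolf_code n X Z m \<phi> \<psi>"
  shows "error_prob (iid_joint n P) \<phi> \<psi> + security_dist n Z (iid_joint n P) m \<phi>
           \<ge> delta n X Z (iid_joint n P)"
  using assms by (intro slepian_wolf_bound set_pmf_iid_joint)

end
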